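(* Let $f_\nu(z)$ and $g_\nu(z)$ be functions of the complex numbers $\nu$ and $z$. Suppose that the family $F_\nu(z)$ satisfies, for all $\nu$ and $z$, $$F_{\nu-1}(z)+F_{\nu+1}(z)=2F_\nu'(z)+f_\nu(z),\qquad F_{\nu-1}(z)-F_{\nu+1}(z)=\frac{2\nu}{z}F_\nu(z)+g_\nu(z),$$ and that the family $G_\nu(z)$ satisfies, for all $\nu$ and $z$, $$G_{\nu-1}(z)-G_{\nu+1}(z)=2G_\nu'(z)+f_\nu(z),\qquad G_{\nu-1}(z)+G_{\nu+1}(z)=\frac{2\nu}{z}G_\nu(z)+g_\nu(z).$$ Let $p_{\nu,l}$, $q_{\nu,l}$, $A_k^n(\nu)$, $B_k^n(\nu)$ be as defined in the context. Let $n\in\mathbb{N}=\{0,1,2,\ldots\}$ and suppose that $p_{\nu,l}(z),q_{\nu,l}(z)\in C^{2n}(\mathbb{C})$ for all $l\in\{0,1,\ldots,2n\}$. Then: (1) for $\nu\in\mathbb{C}\setminus(-[2n-1])$, $$\frac{\mathrm{d}^{2n}}{\mathrm{d}z^{2n}}\left(\frac{F_\nu(z)}{z^\nu}\right)=\sum_{k=0}^nA_k^n(\nu)\frac{F_{\nu+2k}(z)}{z^\nu}+\sum_{j=0}^{n-1}\sum_{k=0}^jA_k^j(\nu)p_{\nu,2k}^{(2n-2j-1)}(z)+\sum_{j=0}^{n-1}\sum_{k=0}^jB_k^j(\nu)p_{\nu,2k+1}^{(2n-2j-2)}(z);$$ (2) for $\nu\in\mathbb{C}\setminus(-[2n])$,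 $$\frac{\mathrm{d}^{2n+1}}{\mathrm{d}z^{2n+1}}\left(\frac{F_\nu(z)}{z^\nu}\right)=\sum_{k=0}^nB_k^n(\nu)\frac{F_{\nu+2k+1}(z)}{z^\nu}+\sum_{j=0}^{n}\sum_{k=0}^jA_k^j(\nu)p_{\nu,2k}^{(2n-2j)}(z)+\sum_{j=0}^{n-1}\sum_{k=0}^jB_k^j(\nu)p_{\nu,2k+1}^{(2n-2j-1)}(z);$$ (3) for $\nu\in\mathbb{C}\setminus[2n-1]$, $$\frac{\mathrm{d}^{2n}}{\mathrm{d}z^{2n}}(z^\nu F_\nu(z))=\sum_{k=0}^nA_k^n(-\nu)z^\nu F_{\nu-2k}(z)+\sum_{j=0}^{n-1}\sum_{k=0}^jA_k^j(-\nu)q_{\nu,2k}^{(2n-2j-1)}(z)+\sum_{j=0}^{n-1}\sum_{k=0}^jB_k^j(-\nu)q_{\nu,2k+1}^{(2n-2j-2)}(z);$$ (4) for $\nu\in\mathbb{C}\setminus[2n]$, $$\frac{\mathrm{d}^{2n+1}}{\mathrm{d}z^{2n+1}}(z^\nu F_\nu(z))=\sum_{k=0}^nB_k^n(-\nu)z^\nu F_{\nu-2k-1}(z)+\sum_{j=0}^{n}\sum_{k=0}^jA_k^j(-\nu)q_{\nu,2k}^{(2n-2j)}(z)+\sum_{j=0}^{n-1}\sum_{k=0}^jB_k^j(-\nu)q_{\nu,2k+1}^{(2n-2j-1)}(z);$$ (5) for $\nu\in\mathbb{C}\setminus(-[2n-1])$, $$\frac{\mathrm{d}^{2n}}{\mathrm{d}z^{2n}}\left(\frac{G_\nu(z)}{z^\nu}\right)=\sum_{k=0}^n(-1)^{n+k}A_k^n(\nu)\frac{G_{\nu+2k}(z)}{z^\nu}+\sum_{j=0}^{n-1}\sum_{k=0}^j(-1)^{k+j}A_k^j(\nu)p_{\nu,2k}^{(2n-2j-1)}(z)+\sum_{j=0}^{n-1}\sum_{k=0}^j(-1)^{k+j+1}B_k^j(\nu)p_{\nu,2k+1}^{(2n-2j-2)}(z);$$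 (6) for $\nu\in\mathbb{C}\setminus(-[2n])$, $$\frac{\mathrm{d}^{2n+1}}{\mathrm{d}z^{2n+1}}\left(\frac{G_\nu(z)}{z^\nu}\right)=\sum_{k=0}^n(-1)^{n+k+1}B_k^n(\nu)\frac{G_{\nu+2k+1}(z)}{z^\nu}+\sum_{j=0}^{n}\sum_{k=0}^j(-1)^{k+j}A_k^j(\nu)p_{\nu,2k}^{(2n-2j)}(z)+\sum_{j=0}^{n-1}\sum_{k=0}^j(-1)^{k+j+1}B_k^j(\nu)p_{\nu,2k+1}^{(2n-2j-1)}(z);$$ (7) for $\nu\in\mathbb{C}\setminus[2n-1]$, $$\frac{\mathrm{d}^{2n}}{\mathrm{d}z^{2n}}(z^\nu G_\nu(z))=\sum_{k=0}^n(-1)^{n+k}A_k^n(-\nu)z^\nu G_{\nu-2k}(z)+\sum_{j=0}^{n-1}\sum_{k=0}^j(-1)^{k+j}A_k^j(-\nu)q_{\nu,2k}^{(2n-2j-1)}(z)+\sum_{j=0}^{n-1}\sum_{k=0}^j(-1)^{k+j}B_k^j(-\nu)q_{\nu,2k+1}^{(2n-2j-2)}(z);$$ (8) for $\nu\in\mathbb{C}\setminus[2n]$, $$\frac{\mathrm{d}^{2n+1}}{\mathrm{d}z^{2n+1}}(z^\nu G_\nu(z))=\sum_{k=0}^n(-1)^{n+k}B_k^n(-\nu)z^\nu G_{\nu-2k-1}(z)+\sum_{j=0}^{n}\sum_{k=0}^j(-1)^{k+j}A_k^j(-\nu)q_{\nu,2k}^{(2n-2j)}(z)+\sum_{j=0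}^{n-1}\sum_{k=0}^j(-1)^{k+j}B_k^j(-\nu)q_{\nu,2k+1}^{(2n-2j-1)}(z).$$
   Context: For $n\in\mathbb{N}=\{0,1,2,\ldots\}$, $0\le k\le n$ and $\nu\in\mathbb{C}$, define $$A_k^n(\nu)=\frac{(2n)!\,(\nu+2k)\prod_{j=0}^{k-1}(2\nu+2j+1)}{2^{2n-k}(2k)!\,(n-k)!\prod_{j=0}^n(\nu+k+j)},\qquad B_k^n(\nu)=\frac{(2n+1)!\,(\nu+2k+1)\prod_{j=0}^{k-1}(2\nu+2j+1)}{2^{2n-k}(2k+1)!\,(n-k)!\prod_{j=0}^n(\nu+k+j+1)},$$ with the empty product equal to $1$. The numerator factor $\nu+2k$ (resp. $\nu+2k+1$) is cancelled against the equal factor $j=k$ of the denominator product; thus $A_k^n(\nu)$ is defined for all $\nu$ other than the integers $-k,-(k+1),\ldots,-(k+n)$ different from $-2k$, and $B_k^n(\nu)$ for all $\nu$ other than the integers $-(k+1),\ldots,-(k+n+1)$ different from $-(2k+1)$. For $l\in\mathbb{N}$ and $\nu\in\mathbb{C}$ define $$p_{\nu,l}(z)=\frac{\nu}{2(\nu+l)}\frac{g_{\nu+l}(z)}{z^\nu}-\frac{f_{\nu+l}(z)}{2z^\nu},\qquad q_{\nu,l}(z)=-\frac{\nu}{2(\nu-l)}z^\nu g_{\nu-l}(z)-\frac12z^\nu f_{\nu-l}(z),$$ with the convention $\frac00:=1$, so that $p_{0,0}(z)=\frac12(g_0(z)-f_0(z))$ and $q_{0,0}(z)=-\frac12(f_0(z)+g_0(z))$.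 The hypothesis $p_{\nu,l},q_{\nu,l}\in C^{2n}(\mathbb{C})$ (as functions of $z$) is imposed on those $p_{\nu,l}$, $q_{\nu,l}$ that are defined. For $N\ge1$, $[N]=\{1,2,\ldots,N\}$ and $-[N]=\{-1,-2,\ldots,-N\}$; $[0],[-1],-[0],-[-1]$ are the empty set. $h^{(n)}(z)$ denotes the $n$-th derivative of $h$ with respect to $z$, primes denote $\mathrm{d}/\mathrm{d}z$, and $\sum_{k=0}^{-1}a_k=0$. Powers $z^{\pm\nu}$ are taken with a fixed branch, and the identities are understood at points $z\ne0$ where the expressions are defined. *)

theory Defs
  imports "HOL-Complex_Analysis.Complex_Analysis"
begin

text \<open>The factor \<open>\<nu> + 2 k\<close> (resp. \<open>\<nu> + 2 k + 1\<close>) of the numerator is cancelled against the factor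
  \<open>j = k\<close> of the product in the denominator, whence the index set \<open>{0..n} - {k}\<close>. Both
  coefficients are only meaningful for \<open>k \<le> n\<close> and off the zeros of the remaining product.\<close>

definition A_coeff :: "nat \<Rightarrow> nat \<Rightarrow> complex \<Rightarrow> complex" where
  "A_coeff k n \<nu> =
     (fact (2 * n) * (\<Prod>j<k. 2 * \<nu> + 2 * of_nat j + 1)) /
     (2 ^ (2 * n - k) * fact (2 * k) * fact (n - k) *
       (\<Prod>j\<in>{0..n} - {k}. \<nu> + of_nat k + of_nat j))"

definition B_coeff :: "nat \<Rightarrow> nat \<Rightarrow> complex \<Rightarrow> complex" where
  "B_coeff k n \<nu> =
     (fact (2 * n + 1) * (\<Prod>j<k. 2 * \<nu> + 2 * of_nat j + 1)) /
     (2 ^ (2 * n - k) * fact (2 * k + 1) * fact (n - k) *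
       (\<Prod>j\<in>{0..n} - {k}. \<nu> + of_nat k + of_nat j + 1))"

text \<open>A fixed branch of all the powers \<open>z\<^sup>\<nu>\<close> at once is given by a branch \<open>L\<close> of the
  logarithm on an open set \<open>D\<close>; the equation \<open>exp (L z) = z\<close> forces \<open>0 \<notin> D\<close>. For example,
  \<open>L = Ln\<close> and \<open>D = - \<real>\<^sub>\<le>\<^sub>0\<close> give the principal branch.\<close>

definition log_branch_on :: "(complex \<Rightarrow> complex) \<Rightarrow> complex set \<Rightarrow> bool" where
  "log_branch_on L D \<longleftrightarrow> open D \<and> continuous_on D L \<and> (\<forall>z\<in>D. exp (L z) = z)"

definition branch_pow :: "(complex \<Rightarrow> complex) \<Rightarrow> complex \<Rightarrow> complex \<Rightarrow> complex" where
  "branch_pow L z \<nu> = exp (\<nu> * L z)"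

definition C_diff_on :: "nat \<Rightarrow> (complex \<Rightarrow> complex) \<Rightarrow> complex set \<Rightarrow> bool" where
  "C_diff_on m h D \<longleftrightarrow>
     (\<forall>i<m. \<forall>z\<in>D. (deriv ^^ i) h field_differentiable at z) \<and>
     continuous_on D ((deriv ^^ m) h)"

text \<open>Division with the convention \<open>0 / 0 = 1\<close>.\<close>

definition quot01 :: "complex \<Rightarrow> complex \<Rightarrow> complex" where
  "quot01 a b = (if a = 0 \<and> b = 0 then 1 else a / b)"

definition quot01_defined :: "complex \<Rightarrow> complex \<Rightarrow> bool" where
  "quot01_defined a b \<longleftrightarrow> (b = 0 \<longrightarrow> a = 0)"

definition p_fun ::
    "(complex \<Rightarrow> complex) \<Rightarrow> (complex \<Rightarrow> complex \<Rightarrow> complex) \<Rightarrow> (complex \<Rightarrow> complex \<Rightarrow> complex) \<Rightarrow>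
     complex \<Rightarrow> nat \<Rightarrow> complex \<Rightarrow> complex" where
  "p_fun L f g \<nu> l z =
     quot01 \<nu> (\<nu> + of_nat l) / 2 * (g (\<nu> + of_nat l) z / branch_pow L z \<nu>)
     - f (\<nu> + of_nat l) z / (2 * branch_pow L z \<nu>)"

definition q_fun ::
    "(complex \<Rightarrow> complex) \<Rightarrow> (complex \<Rightarrow> complex \<Rightarrow> complex) \<Rightarrow> (complex \<Rightarrow> complex \<Rightarrow> complex) \<Rightarrow>
     complex \<Rightarrow> nat \<Rightarrow> complex \<Rightarrow> complex" where
  "q_fun L f g \<nu> l z =
     - (quot01 \<nu> (\<nu> - of_nat l) / 2 * branch_pow L z \<nu> * g (\<nu> - of_nat l) z)
     - 1 / 2 * branch_pow L z \<nu> * f (\<nu> - of_nat l) z"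

definition F_family ::
    "complex set \<Rightarrow> (complex \<Rightarrow> complex \<Rightarrow> complex) \<Rightarrow> (complex \<Rightarrow> complex \<Rightarrow> complex) \<Rightarrow>
     (complex \<Rightarrow> complex \<Rightarrow> complex) \<Rightarrow> bool" where
  "F_family D f g F \<longleftrightarrow>
     (\<forall>\<nu>. \<forall>z\<in>D.
        F \<nu> field_differentiable at z \<and>
        F (\<nu> - 1) z + F (\<nu> + 1) z = 2 * deriv (F \<nu>) z + f \<nu> z \<and>
        F (\<nu> - 1) z - F (\<nu> + 1) z = 2 * \<nu> / z * F \<nu> z + g \<nu> z)"

definition G_family ::
    "complex set \<Rightarrow> (complex \<Rightarrow> complex \<Rightarrow> complex) \<Rightarrow> (complex \<Rightarrow> complex \<Rightarrow> complex) \<Rightarrow>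
     (complex \<Rightarrow> complex \<Rightarrow> complex) \<Rightarrow> bool" where
  "G_family D f g G \<longleftrightarrow>
     (\<forall>\<nu>. \<forall>z\<in>D.
        G \<nu> field_differentiable at z \<and>
        G (\<nu> - 1) z - G (\<nu> + 1) z = 2 * deriv (G \<nu>) z + f \<nu> z \<and>
        G (\<nu> - 1) z + G (\<nu> + 1) z = 2 * \<nu> / z * G \<nu> z + g \<nu> z)"

text \<open>The set \<open>[N] = {1, \<dots>, N}\<close>. Truncated subtraction makes \<open>pos_upto (2 * n - 1)\<close> empty for
  \<open>n = 0\<close>, in accordance with \<open>[-1] = {}\<close>.\<close>

definition pos_upto :: "nat \<Rightarrow> complex set" where
  "pos_upto N = of_nat ` {1..N}"

end

theory Submission
  imports Defs
begin

text \<open>For \<open>\<Phi>\<^sub>l = F\<^bsub>\<nu>+l\<^esub> / z\<^sup>\<nu>\<close> the two recurrences of \<open>F\<close> combine to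
  \<open>\<Phi>\<^sub>l' = l / (2 (\<nu> + l)) \<Phi>\<^bsub>l-1\<^esub> + (2 \<nu> + l) / (2 (\<nu> + l)) \<Phi>\<^bsub>l+1\<^esub> + p\<^bsub>\<nu>,l\<^esub>\<close>, and the coefficients are
  \<open>(1 \<mp> c) / 2\<close> with \<open>c = \<nu> / (\<nu> + l)\<close>, which covers \<open>\<nu> = l = 0\<close> through \<open>0 / 0 = 1\<close>.
  Iterated differentiation of \<open>\<Phi>\<^sub>0\<close> thus amounts to two recurrences that lead from \<open>A\<^sup>n\<close> to \<open>B\<^sup>n\<close> and
  from \<open>B\<^sup>n\<close> to \<open>A\<^bsup>n+1\<^esup>\<close>. The functions \<open>z\<^sup>\<nu> F\<^bsub>\<nu>-l\<^esub>\<close> obey the same chain with \<open>- \<nu>\<close> in place of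
  \<open>\<nu>\<close>, and for \<open>G\<close> one of the two coefficients changes its sign.\<close>

subsection \<open>Recurrences for the coefficients\<close>

lemma quot01_minus: "quot01 (- a) (- b) = quot01 a b"
  by (simp add: quot01_def)

definition up_weight :: "complex \<Rightarrow> nat \<Rightarrow> complex" where
  "up_weight \<nu> l = (1 + quot01 \<nu> (\<nu> + of_nat l)) / 2"

definition down_weight :: "complex \<Rightarrow> nat \<Rightarrow> complex" where
  "down_weight \<nu> l = (1 - quot01 \<nu> (\<nu> + of_nat l)) / 2"

lemma up_weight_0 [simp]: "up_weight \<nu> 0 = 1"
  by (simp add: up_weight_def quot01_def)

text \<open>The convention 0/0 = 1 makes this hold at \<open>\<nu> = 0\<close> too. It later renders
  the truncated index \<open>l - 1\<close> harmless at \<open>l = 0\<close>.\<close>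

lemma down_weight_0 [simp]: "down_weight \<nu> 0 = 0"
  by (simp add: down_weight_def quot01_def)

lemma up_weight_eq:
  assumes "\<nu> + of_nat l \<noteq> 0"
  shows "up_weight \<nu> l = (2 * \<nu> + of_nat l) / (2 * (\<nu> + of_nat l))"
proof -
  have "quot01 \<nu> (\<nu> + of_nat l) = \<nu> / (\<nu> + of_nat l)"
    using assms by (simp add: quot01_def)
  then show ?thesis
    using assms by (simp add: up_weight_def add_divide_distrib [symmetric] add_num_frac)
qed

lemma down_weight_eq:
  assumes "\<nu> + of_nat l \<noteq> 0"
  shows "down_weight \<nu> l = of_nat l / (2 * (\<nu> + of_nat l))"
proof -
  have "quot01 \<nu> (\<nu> + of_nat l) = \<nu> / (\<nu> + of_nat l)"
    using assms by (simp add: quot01_def)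
  then have "1 - quot01 \<nu> (\<nu> + of_nat l) = of_nat l / (\<nu> + of_nat l)"
    using assms by (simp add: eq_divide_eq left_diff_distrib)
  then show ?thesis by (simp add: down_weight_def)
qed

section \<open>Coefficients written with Pochhammer symbols\<close>

lemma prod_remove_pochhammer:
  fixes x :: complex
  assumes "k \<le> n" "x + of_nat k \<noteq> 0"
  shows "(\<Prod>j\<in>{0..n} - {k}. x + of_nat j) = pochhammer x (Suc n) / (x + of_nat k)"
proof -
  have "{0..<Suc n} = {0..n}" by auto
  then have "pochhammer x (Suc n) = (x + of_nat k) * (\<Prod>j\<in>{0..n} - {k}. x + of_nat j)"
    using assms by (subst pochhammer_prod) (simp add: prod.remove [of "{0..n}" k])
  then show ?thesis using assms by simp
qed

text \<open>Restoring the cancelled factor completes the product to a Pochhammer symbol, whose first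
  and last factors can be split off in the recurrences. This fails at the zero of that factor, a
  restriction that the separate forms for \<open>k = n\<close> and \<open>k = 0\<close> below
  avoid.\<close>

lemma A_coeff_eq:
  assumes "k \<le> n" "\<nu> + 2 * of_nat k \<noteq> 0"
  shows "A_coeff k n \<nu> =
     (fact (2 * n) * (\<Prod>j<k. 2 * \<nu> + 2 * of_nat j + 1) * (\<nu> + 2 * of_nat k)) /
     (2 ^ (2 * n - k) * fact (2 * k) * fact (n - k) * pochhammer (\<nu> + of_nat k) (Suc n))"
proof -
  have "(\<Prod>j\<in>{0..n} - {k}. \<nu> + of_nat k + of_nat j)
      = pochhammer (\<nu> + of_nat k) (Suc n) / (\<nu> + 2 * of_nat k)"
    using prod_remove_pochhammer [OF assms(1), of "\<nu> + of_nat k"] assms(2) by (simp add: add.assoc)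
  then show ?thesis by (simp add: A_coeff_def)
qed

lemma B_coeff_eq:
  assumes "k \<le> n" "\<nu> + 2 * of_nat k + 1 \<noteq> 0"
  shows "B_coeff k n \<nu> =
     (fact (2 * n + 1) * (\<Prod>j<k. 2 * \<nu> + 2 * of_nat j + 1) * (\<nu> + 2 * of_nat k + 1)) /
     (2 ^ (2 * n - k) * fact (2 * k + 1) * fact (n - k) * pochhammer (\<nu> + of_nat k + 1) (Suc n))"
proof -
  have "(\<Prod>j\<in>{0..n} - {k}. \<nu> + of_nat k + of_nat j + 1)
      = (\<Prod>j\<in>{0..n} - {k}. \<nu> + of_nat k + 1 + of_nat j)"
    by (simp add: add_ac)
  also have "\<dots> = pochhammer (\<nu> + of_nat k + 1) (Suc n) / (\<nu> + 2 * of_nat k + 1)"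
    using prod_remove_pochhammer [OF assms(1), of "\<nu> + of_nat k + 1"] assms(2) by (simp add: add_ac)
  finally show ?thesis unfolding B_coeff_def by simp
qed

lemma A_coeff_top:
  "A_coeff n n \<nu> = (\<Prod>j<n. 2 * \<nu> + 2 * of_nat j + 1) / (2 ^ n * pochhammer (\<nu> + of_nat n) n)"
proof -
  have "{0..n} - {n} = {0..<n}" by auto
  then show ?thesis by (simp add: A_coeff_def pochhammer_prod)
qed

lemma B_coeff_top:
  "B_coeff n n \<nu> = (\<Prod>j<n. 2 * \<nu> + 2 * of_nat j + 1) / (2 ^ n * pochhammer (\<nu> + of_nat n + 1) n)"
proof -
  have "(\<Prod>j\<in>{0..n} - {n}. \<nu> + of_nat n + of_nat j + 1) = pochhammer (\<nu> + of_nat n + 1) n"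
    unfolding pochhammer_prod by (rule prod.cong) (auto simp: add_ac)
  then show ?thesis unfolding B_coeff_def by (simp del: fact_Suc)
qed

text \<open>For \<open>k = 0\<close> the removed factor is \<open>\<nu>\<close> itself, and shifting
  the index gives a symbol that starts at \<open>\<nu> + 1\<close>. Thus \<open>\<nu> = 0\<close> is
  covered, where \<open>A_coeff_eq\<close> does not apply.\<close>

lemma A_coeff_0: "A_coeff 0 n \<nu> = fact (2 * n) / (2 ^ (2 * n) * fact n * pochhammer (\<nu> + 1) n)"
proof -
  have "(\<Prod>j\<in>{0..n} - {0}. \<nu> + of_nat j) = pochhammer (\<nu> + 1) n"
    unfolding pochhammer_prod
    by (rule prod.reindex_bij_witness [of _ Suc "\<lambda>j. j - 1"]) auto
  then show ?thesis by (simp add: A_coeff_def)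
qed

section \<open>Recurrences between the coefficients, index by index\<close>

lemma pochhammer_shift_nonzero:
  fixes \<nu> :: complex
  assumes "\<And>l. l \<in> {a..<a + m} \<Longrightarrow> \<nu> + of_nat l \<noteq> 0"
  shows "pochhammer (\<nu> + of_nat a) m \<noteq> 0"
proof -
  have "\<nu> + of_nat a + of_nat j \<noteq> 0" if "j < m" for j
    using assms [of "a + j"] that by (simp add: add.assoc)
  then show ?thesis by (auto simp: pochhammer_prod)
qed

text \<open>The top index 2n+1 is reached only by a step up from 2n. For n > 0 both denominators
  contain \<open>X\<close>; \<open>A\<close> has the extra factor \<nu>+n and \<open>B\<close> the
  extra factor \<nu>+2n, and the weight is the quotient of the two.\<close>

lemma B_coeff_rec_top:
  assumes "\<And>l. l \<in> {1..2 * n} \<Longrightarrow> \<nu> + of_nat l \<noteq> 0"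
  shows "B_coeff n n \<nu> = up_weight \<nu> (2 * n) * A_coeff n n \<nu>"
proof (cases n)
  case 0
  then show ?thesis by (simp add: A_coeff_def B_coeff_def)
next
  case (Suc m)
  define P where "P = (\<Prod>j<n. 2 * \<nu> + 2 * of_nat j + 1)"
  define X where "X = pochhammer (\<nu> + of_nat n + 1) m"
  have nz: "\<nu> + of_nat n \<noteq> 0" "\<nu> + of_nat (2 * n) \<noteq> 0"
    using assms [of n] assms [of "2 * n"] Suc by auto
  have "A_coeff n n \<nu> = P / (2 ^ n * ((\<nu> + of_nat n) * X))"
    unfolding A_coeff_top P_def [symmetric] X_def using Suc
    by (simp add: pochhammer_rec add_ac)
  moreover have "pochhammer (\<nu> + of_nat n + 1) n = X * (\<nu> + of_nat (2 * n))"
    unfolding X_def Suc pochhammer_Suc by (simp add: add_ac)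
  then have "B_coeff n n \<nu> = P / (2 ^ n * (X * (\<nu> + of_nat (2 * n))))"
    unfolding B_coeff_top P_def [symmetric] by simp
  moreover have "up_weight \<nu> (2 * n) = (\<nu> + of_nat n) / (\<nu> + of_nat (2 * n))"
    unfolding up_weight_eq [OF nz(2)] by (subst mult_divide_mult_cancel_left [of 2, symmetric]) simp_all
  ultimately show ?thesis
    using nz by (simp del: of_nat_mult)
qed

text \<open>Again a single step up leads to the top. It adds 2\<nu>+2n+1 to the product in the
  numerator and \<nu>+2n+1 to the Pochhammer symbol, which together with a factor 2 is exactly the
  weight.\<close>

lemma A_coeff_rec_top:
  assumes "\<nu> + of_nat (2 * n + 1) \<noteq> 0"
  shows "A_coeff (Suc n) (Suc n) \<nu> = up_weight \<nu> (2 * n + 1) * B_coeff n n \<nu>"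
proof -
  define P where "P = (\<Prod>j<n. 2 * \<nu> + 2 * of_nat j + 1)"
  define X where "X = pochhammer (\<nu> + of_nat n + 1) n"
  have "pochhammer (\<nu> + of_nat (Suc n)) (Suc n) = X * (\<nu> + of_nat (2 * n + 1))"
    unfolding X_def pochhammer_Suc by (simp add: add_ac)
  then have "A_coeff (Suc n) (Suc n) \<nu> =
      P * (2 * \<nu> + of_nat (2 * n + 1)) / (2 ^ Suc n * (X * (\<nu> + of_nat (2 * n + 1))))"
    unfolding A_coeff_top by (simp add: P_def add_ac)
  moreover have "B_coeff n n \<nu> = P / (2 ^ n * X)"
    unfolding B_coeff_top P_def X_def ..
  ultimately show ?thesis
    unfolding up_weight_eq [OF assms] by (simp add: mult_ac del: of_nat_mult of_nat_add)
qed

text \<open>Index 0 is reached only by a step down from 1. The quotient of (2n+2)! by (n+1)!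
  contributes just a factor 2 beyond (2n+1)!/n!, and \<nu>+1 in the weight cancels against the
  numerator of \<open>B\<close>.\<close>

lemma A_coeff_rec_0:
  assumes "\<nu> + 1 \<noteq> 0"
  shows "A_coeff 0 (Suc n) \<nu> = down_weight \<nu> 1 * B_coeff 0 n \<nu>"
proof -
  define X where "X = pochhammer (\<nu> + 1) (Suc n)"
  define N :: complex where "N = of_nat (Suc n)"
  have "N \<noteq> 0"
    unfolding N_def by (rule of_nat_neq_0)
  have "A_coeff 0 (Suc n) \<nu> = fact (2 * n + 1) * (2 * N) /
      (2 * 2 * 2 ^ (2 * n) * (N * fact n) * X)"
    unfolding A_coeff_0 X_def [symmetric] N_def by (simp add: algebra_simps)
  also have "\<dots> = fact (2 * n + 1) / (2 * 2 ^ (2 * n) * fact n * X)"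
    using \<open>N \<noteq> 0\<close> by (simp del: fact_Suc)
  also have "\<dots> = down_weight \<nu> 1 * B_coeff 0 n \<nu>"
    using assms down_weight_eq [of \<nu> 1] B_coeff_eq [of 0 n \<nu>]
    by (simp add: X_def del: fact_Suc distrib_left_numeral)
  finally show ?thesis .
qed

text \<open>The interior index 2k+1 is reached by a step up from 2k and a step down from 2k+2. Over
  a common denominator all three terms share the same factors, and the polynomial identity
  \<open>key\<close> remains.\<close>

lemma B_coeff_rec:
  assumes "k < n" and nz: "\<And>l. l \<in> {1..2 * n} \<Longrightarrow> \<nu> + of_nat l \<noteq> 0"
  shows "B_coeff k n \<nu> = up_weight \<nu> (2 * k) * A_coeff k n \<nu>
           + down_weight \<nu> (2 * k + 2) * A_coeff (Suc k) n \<nu>"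
proof -
  obtain d where n: "n = Suc (k + d)"
    using \<open>k < n\<close> less_iff_Suc_add by blast
  define P where "P = (\<Prod>j<k. 2 * \<nu> + 2 * of_nat j + 1)"
  define X where "X = pochhammer (\<nu> + of_nat k + 1) n"
  \<comment> \<open>The last factor \<nu>+k+1+n of the Pochhammer symbol of length
    \<open>Suc n\<close> that starts at \<nu>+k+1; \<open>X\<close> is the product of the other
    factors.\<close>
  define E where "E = \<nu> + 2 * of_nat k + of_nat d + 2"
  define C :: complex where "C = 2 ^ (k + 2 * d + 1) * fact (2 * k) * fact d"
  have k1: "(2 * of_nat k + 1 :: complex) \<noteq> 0" "(2 * of_nat k + 2 :: complex) \<noteq> 0"
    and d1: "(of_nat d + 1 :: complex) \<noteq> 0"
    using of_nat_neq_0 [of "2 * k", where 'a = complex] of_nat_neq_0 [of "2 * k + 1", where 'a = complex]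
      of_nat_neq_0 [of d, where 'a = complex] by (simp_all add: add_ac)
  have nz': "\<nu> + 2 * of_nat k + 1 \<noteq> 0" "\<nu> + 2 * of_nat k + 2 \<noteq> 0" "E \<noteq> 0"
    using nz [of "2 * k + 1"] nz [of "2 * k + 2"] nz [of "k + n + 1"] n
    by (simp_all add: add_ac E_def)
  have "X \<noteq> 0"
    using pochhammer_shift_nonzero [of "Suc k" n \<nu>] nz n by (simp add: X_def add_ac)
  have "C \<noteq> 0" by (simp add: C_def)
  have pow: "2 * n - k = Suc (k + 2 * d + 1)" "2 * n - Suc k = k + 2 * d + 1"
    "n - k = Suc d" "n - Suc k = d"
    using n by auto
  have S: "pochhammer (\<nu> + of_nat k + 1) (Suc n) = X * E"
    unfolding X_def E_def pochhammer_Suc by (simp add: n)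
  have B: "B_coeff k n \<nu> = fact (2 * n) * P * ((2 * of_nat n + 1) * (\<nu> + 2 * of_nat k + 1)) /
     (2 * C * (2 * of_nat k + 1) * (of_nat d + 1) * (X * E))"
  proof -
    have "fact (2 * n + 1) = (2 * of_nat n + 1) * (fact (2 * n) :: complex)"
      "fact (2 * k + 1) = (2 * of_nat k + 1) * (fact (2 * k) :: complex)"
      "fact (Suc d) = (of_nat d + 1) * (fact d :: complex)" by simp_all
    then show ?thesis
      using B_coeff_eq [of k n \<nu>] nz' n unfolding pow S P_def [symmetric] C_def
      by (simp add: mult_ac del: fact_Suc)
  qed
  have up: "up_weight \<nu> (2 * k) * A_coeff k n \<nu> = fact (2 * n) * P / (2 * C * (of_nat d + 1) * X)"
  \<comment> \<open>For k = 0 the numerator factor \<nu>+2k may vanish, so it cannot be restored and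
    cancelled.\<close>
  proof (cases "k = 0")
    case True
    then show ?thesis using n by (simp add: A_coeff_0 P_def C_def X_def)
  next
    case False
    have nz'': "\<nu> + of_nat k \<noteq> 0" "\<nu> + of_nat (2 * k) \<noteq> 0"
      using False nz [of k] nz [of "2 * k"] n by auto
    have "up_weight \<nu> (2 * k) = (\<nu> + of_nat k) / (\<nu> + 2 * of_nat k)"
      unfolding up_weight_eq [OF nz''(2)] by (subst mult_divide_mult_cancel_left [of 2, symmetric]) simp_all
    moreover have "pochhammer (\<nu> + of_nat k) (Suc n) = (\<nu> + of_nat k) * X"
      by (simp add: pochhammer_rec X_def)
    moreover have "fact (Suc d) = (of_nat d + 1) * (fact d :: complex)" by simp
    ultimately show ?thesis
      using A_coeff_eq [of k n \<nu>] nz'' n unfolding pow P_def [symmetric] C_def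
      by (simp add: mult_ac del: fact_Suc)
  qed
  have down: "down_weight \<nu> (2 * k + 2) * A_coeff (Suc k) n \<nu> =
      fact (2 * n) * P * (2 * \<nu> + 2 * of_nat k + 1) / (2 * C * (2 * of_nat k + 1) * (X * E))"
  proof -
    \<comment> \<open>\<open>V\<close> cancels between the weight and (2k+2)!, and \<open>W\<close>
      between the weight and the restored numerator factor.\<close>
    define V W T :: complex where "V = 2 * of_nat k + 2" and "W = \<nu> + 2 * of_nat k + 2"
      and "T = 2 * of_nat k + 1"
    have "V \<noteq> 0" "W \<noteq> 0"
      using k1 nz' by (simp_all add: V_def W_def)
    have "down_weight \<nu> (2 * k + 2) = V / (2 * W)"
      using down_weight_eq [of \<nu> "2 * k + 2"] nz'(2) by (simp add: V_def W_def add_ac)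
    moreover have "A_coeff (Suc k) n \<nu> = fact (2 * n) * (P * (2 * \<nu> + 2 * of_nat k + 1)) * W /
        (2 ^ (k + 2 * d + 1) * (V * (T * fact (2 * k))) * fact d * (X * E))"
    proof -
      have "fact (2 * Suc k) = V * (T * (fact (2 * k) :: complex))"
        by (simp add: V_def T_def algebra_simps)
      moreover have "pochhammer (\<nu> + of_nat (Suc k)) (Suc n) = X * E"
        using S by (simp only: of_nat_Suc add_ac)
      moreover have "(\<Prod>j<Suc k. 2 * \<nu> + 2 * of_nat j + 1) = P * (2 * \<nu> + 2 * of_nat k + 1)"
        by (simp add: P_def)
      moreover have "\<nu> + 2 * of_nat (Suc k) = W" by (simp add: W_def)
      ultimately show ?thesis
        using A_coeff_eq [of "Suc k" n \<nu>] \<open>W \<noteq> 0\<close> \<open>k < n\<close> by (simp only: pow Suc_le_eq) simp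
    qed
    ultimately show ?thesis
      using \<open>V \<noteq> 0\<close> \<open>W \<noteq> 0\<close> unfolding C_def T_def [symmetric] by (simp add: mult_ac)
  qed
  \<comment> \<open>This rests on 2n+1 = (2k+1) + 2(d+1). The first summand belongs to the step up,
    the second to the step down.\<close>
  have key: "(2 * of_nat n + 1) * (\<nu> + 2 * of_nat k + 1) =
      (2 * of_nat k + 1) * E + (of_nat d + 1) * (2 * \<nu> + 2 * of_nat k + 1)"
    unfolding n E_def by (simp add: algebra_simps)
  show ?thesis
    unfolding B up down key using \<open>X \<noteq> 0\<close> \<open>C \<noteq> 0\<close> nz' k1 d1
    by (simp add: divide_simps) (simp add: algebra_simps)
qed

text \<open>The target 2k+2 is reached by a step down from 2k+3 and a step up from 2k+1. The three
  Pochhammer symbols are \<open>X\<close> extended by the first factor \<open>H\<close>, by the last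
  factor \<open>E\<close>, and by both.\<close>

lemma A_coeff_rec:
  assumes "k < n" and nz: "\<And>l. l \<in> {1..2 * n + 1} \<Longrightarrow> \<nu> + of_nat l \<noteq> 0"
  shows "A_coeff (Suc k) (Suc n) \<nu> = down_weight \<nu> (2 * Suc k + 1) * B_coeff (Suc k) n \<nu>
           + up_weight \<nu> (2 * k + 1) * B_coeff k n \<nu>"
proof -
  obtain d where n: "n = Suc (k + d)"
    using \<open>k < n\<close> less_iff_Suc_add by blast
  define P where "P = (\<Prod>j<k. 2 * \<nu> + 2 * of_nat j + 1)"
  define Q where "Q = 2 * \<nu> + 2 * of_nat k + 1"
  define X where "X = pochhammer (\<nu> + of_nat k + 2) n"
  define E where "E = \<nu> + 2 * of_nat k + of_nat d + 3"
  define H where "H = \<nu> + of_nat k + 1"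
  define C :: complex where "C = 2 ^ (k + 2 * d + 1) * fact (2 * k + 1) * fact d"
  define V M N :: complex where "V = 2 * of_nat k + 2" and "M = of_nat d + 1" and "N = 2 * of_nat n + 2"
  have "V \<noteq> 0" "M \<noteq> 0"
    using of_nat_neq_0 [of "2 * k + 1", where 'a = complex]
      of_nat_neq_0 [of d, where 'a = complex] by (simp_all add: add_ac V_def M_def)
  have nz': "\<nu> + 2 * of_nat k + 1 \<noteq> 0" "\<nu> + 2 * of_nat k + 2 \<noteq> 0" "\<nu> + 2 * of_nat k + 3 \<noteq> 0"
      "E \<noteq> 0" "H \<noteq> 0"
    using nz [of "2 * k + 1"] nz [of "2 * k + 2"] nz [of "2 * k + 3"] nz [of "k + n + 2"] nz [of "k + 1"] n
    by (simp_all add: add_ac E_def H_def)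
  have "X \<noteq> 0"
    using pochhammer_shift_nonzero [of "k + 2" n \<nu>] nz n by (simp add: X_def add_ac)
  have "C \<noteq> 0" by (simp add: C_def del: fact_Suc)
  have pow: "2 * n - k = Suc (k + 2 * d + 1)" "2 * n - Suc k = k + 2 * d + 1"
    "2 * Suc n - Suc k = Suc (Suc (k + 2 * d + 1))"
    "n - k = Suc d" "n - Suc k = d" "Suc n - Suc k = Suc d"
    using n by auto
  have prod_Suc: "(\<Prod>j<Suc k. 2 * \<nu> + 2 * of_nat j + 1) = P * Q"
    by (simp add: P_def Q_def)
  have fact_d: "fact (Suc d) = M * (fact d :: complex)"
    by (simp add: M_def)
  have XE: "pochhammer (\<nu> + of_nat (Suc k) + 1) (Suc n) = X * E"
    unfolding X_def E_def pochhammer_Suc by (simp add: n add_ac)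
  have HX: "pochhammer (\<nu> + of_nat k + 1) (Suc n) = H * X"
    unfolding X_def H_def pochhammer_rec by (simp add: add_ac)
  have HXE: "pochhammer (\<nu> + of_nat (Suc k)) (Suc (Suc n)) = H * X * E"
  proof -
    have "pochhammer (\<nu> + of_nat (Suc k)) (Suc (Suc n))
        = (\<nu> + of_nat (Suc k)) * pochhammer (\<nu> + of_nat (Suc k) + 1) (Suc n)"
      by (rule pochhammer_rec)
    then show ?thesis unfolding XE H_def by (simp add: add_ac)
  qed
  have A: "A_coeff (Suc k) (Suc n) \<nu> =
      fact (2 * n + 1) * P * Q * (N * (\<nu> + 2 * of_nat k + 2)) / (4 * C * V * M * (H * X * E))"
  proof -
    have "fact (2 * Suc k) = V * (fact (2 * k + 1) :: complex)"
      by (simp add: V_def algebra_simps)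
    moreover have "fact (2 * Suc n) = N * (fact (2 * n + 1) :: complex)"
      by (simp add: N_def algebra_simps)
    moreover have "\<nu> + 2 * of_nat (Suc k) = \<nu> + 2 * of_nat k + 2" by simp
    ultimately have "A_coeff (Suc k) (Suc n) \<nu> =
        N * fact (2 * n + 1) * (P * Q) * (\<nu> + 2 * of_nat k + 2) /
        (2 ^ Suc (Suc (k + 2 * d + 1)) * (V * fact (2 * k + 1)) * (M * fact d) * (H * X * E))"
      using A_coeff_eq [of "Suc k" "Suc n" \<nu>] nz'(2) \<open>k < n\<close>
      by (simp only: pow prod_Suc fact_d HXE not_False_eq_True Suc_le_mono less_imp_le)
    then show ?thesis
      unfolding C_def by (simp add: mult_ac del: fact_Suc)
  qed
  have down: "down_weight \<nu> (2 * Suc k + 1) * B_coeff (Suc k) n \<nu> =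
      fact (2 * n + 1) * P * Q / (2 * C * V * (X * E))"
  proof -
    define W T :: complex where "W = \<nu> + 2 * of_nat k + 3" and "T = 2 * of_nat k + 3"
    have "W \<noteq> 0" "T \<noteq> 0"
      using nz' of_nat_neq_0 [of "2 * k + 2", where 'a = complex] by (simp_all add: W_def T_def add_ac)
    have "down_weight \<nu> (2 * Suc k + 1) = T / (2 * W)"
      using down_weight_eq [of \<nu> "2 * Suc k + 1"] nz'(3) by (simp add: T_def W_def add_ac)
    moreover have "B_coeff (Suc k) n \<nu> = fact (2 * n + 1) * (P * Q) * W /
        (2 ^ (k + 2 * d + 1) * (T * (V * fact (2 * k + 1))) * fact d * (X * E))"
    proof -
      have "fact (2 * Suc k + 1) = T * (V * (fact (2 * k + 1) :: complex))"
        by (simp add: V_def T_def algebra_simps)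
      moreover have "\<nu> + 2 * of_nat (Suc k) + 1 = W" by (simp add: W_def)
      ultimately show ?thesis
        using B_coeff_eq [of "Suc k" n \<nu>] \<open>W \<noteq> 0\<close> \<open>k < n\<close>
        by (simp only: pow prod_Suc XE Suc_le_eq) simp
    qed
    ultimately show ?thesis
      using \<open>T \<noteq> 0\<close> \<open>W \<noteq> 0\<close> unfolding C_def by (simp add: mult_ac del: fact_Suc)
  qed
  have up: "up_weight \<nu> (2 * k + 1) * B_coeff k n \<nu> =
      fact (2 * n + 1) * P * Q / (4 * C * M * (H * X))"
  proof -
    define W where "W = \<nu> + 2 * of_nat k + 1"
    have "W \<noteq> 0" using nz' by (simp add: W_def)
    have "up_weight \<nu> (2 * k + 1) = Q / (2 * W)"
      using up_weight_eq [of \<nu> "2 * k + 1"] nz'(1) by (simp add: Q_def W_def add_ac)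
    moreover have "B_coeff k n \<nu> = fact (2 * n + 1) * P * W /
        (2 ^ Suc (k + 2 * d + 1) * fact (2 * k + 1) * (M * fact d) * (H * X))"
      using B_coeff_eq [of k n \<nu>] nz'(1) \<open>k < n\<close>
      by (simp only: pow HX P_def W_def fact_d less_imp_le) simp
    ultimately show ?thesis
      using \<open>W \<noteq> 0\<close> unfolding C_def by (simp add: mult_ac del: fact_Suc)
  qed
  \<comment> \<open>This rests on \<open>N = V + 2 * M\<close>. Here the first summand belongs to
    the step down and the second to the step up.\<close>
  have key: "N * (\<nu> + 2 * of_nat k + 2) = 2 * M * H + V * E"
    unfolding n E_def M_def N_def V_def H_def by (simp add: algebra_simps)
  show ?thesis
    unfolding A up down key using \<open>X \<noteq> 0\<close> \<open>C \<noteq> 0\<close> \<open>V \<noteq> 0\<close> \<open>M \<noteq> 0\<close> nz'(4,5)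
    by (simp add: divide_simps) (simp add: algebra_simps)
qed

section \<open>The recurrences in summed form\<close>

lemma sum_A_coeff_step:
  fixes x :: "nat \<Rightarrow> complex"
  assumes nz: "\<And>l. l \<in> {1..2 * n} \<Longrightarrow> \<nu> + of_nat l \<noteq> 0"
  shows "(\<Sum>k\<le>n. A_coeff k n \<nu> * (down_weight \<nu> (2 * k) * x (2 * k - 1) + up_weight \<nu> (2 * k) * x (2 * k + 1)))
       = (\<Sum>k\<le>n. B_coeff k n \<nu> * x (2 * k + 1))"
proof -
  \<comment> \<open>Shifting k by one makes the steps down aim at 2k+1. The term lost at k = 0 has
    weight 0, so its truncated index does not matter.\<close>
  have "(\<Sum>k\<le>n. A_coeff k n \<nu> * (down_weight \<nu> (2 * k) * x (2 * k - 1)))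
      = (\<Sum>k<n. down_weight \<nu> (2 * k + 2) * A_coeff (Suc k) n \<nu> * x (2 * k + 1))"
    by (subst sum.atMost_shift) (simp add: mult_ac)
  moreover have top: "B_coeff n n \<nu> = up_weight \<nu> (2 * n) * A_coeff n n \<nu>"
    by (rule B_coeff_rec_top) (rule nz)
  moreover have "(\<Sum>k\<le>n. A_coeff k n \<nu> * (up_weight \<nu> (2 * k) * x (2 * k + 1)))
      = (\<Sum>k<n. up_weight \<nu> (2 * k) * A_coeff k n \<nu> * x (2 * k + 1)) + B_coeff n n \<nu> * x (2 * n + 1)"
    by (simp add: top mult_ac flip: lessThan_Suc_atMost)
  moreover have "(\<Sum>k\<le>n. B_coeff k n \<nu> * x (2 * k + 1))
      = (\<Sum>k<n. B_coeff k n \<nu> * x (2 * k + 1)) + B_coeff n n \<nu> * x (2 * n + 1)"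
    by (simp flip: lessThan_Suc_atMost)
  moreover have "(\<Sum>k<n. B_coeff k n \<nu> * x (2 * k + 1))
      = (\<Sum>k<n. up_weight \<nu> (2 * k) * A_coeff k n \<nu> * x (2 * k + 1))
      + (\<Sum>k<n. down_weight \<nu> (2 * k + 2) * A_coeff (Suc k) n \<nu> * x (2 * k + 1))"
    unfolding sum.distrib [symmetric] by (rule sum.cong) (simp_all only: B_coeff_rec [OF _ nz] lessThan_iff distrib_right)
  ultimately show ?thesis
    by (simp add: distrib_left sum.distrib)
qed

lemma sum_B_coeff_step:
  fixes x :: "nat \<Rightarrow> complex"
  assumes nz: "\<And>l. l \<in> {1..2 * n + 1} \<Longrightarrow> \<nu> + of_nat l \<noteq> 0"
  shows "(\<Sum>k\<le>n. B_coeff k n \<nu> * (down_weight \<nu> (2 * k + 1) * x (2 * k) + up_weight \<nu> (2 * k + 1) * x (2 * k + 2)))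
       = (\<Sum>k\<le>Suc n. A_coeff k (Suc n) \<nu> * x (2 * k))"
proof -
  have nz1: "\<nu> + 1 \<noteq> 0" and nz2: "\<nu> + of_nat (2 * n + 1) \<noteq> 0"
    using nz [of 1] nz [of "2 * n + 1"] by (simp_all del: of_nat_add of_nat_mult)
  \<comment> \<open>The step down from 1 alone yields the bottom term and the step up from 2n+1
    alone the top term; all other targets receive one step of each kind.\<close>
  have "(\<Sum>k\<le>n. B_coeff k n \<nu> * (down_weight \<nu> (2 * k + 1) * x (2 * k)))
      = A_coeff 0 (Suc n) \<nu> * x 0
      + (\<Sum>k<n. down_weight \<nu> (2 * Suc k + 1) * B_coeff (Suc k) n \<nu> * x (2 * Suc k))"
    by (subst sum.atMost_shift) (simp add: A_coeff_rec_0 [OF nz1] mult_ac)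
  moreover have "(\<Sum>k\<le>n. B_coeff k n \<nu> * (up_weight \<nu> (2 * k + 1) * x (2 * k + 2)))
      = (\<Sum>k<n. up_weight \<nu> (2 * k + 1) * B_coeff k n \<nu> * x (2 * Suc k))
      + A_coeff (Suc n) (Suc n) \<nu> * x (2 * Suc n)"
    by (simp add: A_coeff_rec_top [OF nz2] mult_ac flip: lessThan_Suc_atMost)
  moreover have "(\<Sum>k\<le>Suc n. A_coeff k (Suc n) \<nu> * x (2 * k)) = A_coeff 0 (Suc n) \<nu> * x 0
      + (\<Sum>k<n. A_coeff (Suc k) (Suc n) \<nu> * x (2 * Suc k)) + A_coeff (Suc n) (Suc n) \<nu> * x (2 * Suc n)"
    by (subst sum.atMost_shift) simp
  moreover have "(\<Sum>k<n. A_coeff (Suc k) (Suc n) \<nu> * x (2 * Suc k))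
      = (\<Sum>k<n. down_weight \<nu> (2 * Suc k + 1) * B_coeff (Suc k) n \<nu> * x (2 * Suc k))
      + (\<Sum>k<n. up_weight \<nu> (2 * k + 1) * B_coeff k n \<nu> * x (2 * Suc k))"
    unfolding sum.distrib [symmetric] by (rule sum.cong) (simp_all only: A_coeff_rec [OF _ nz] lessThan_iff distrib_right)
  ultimately show ?thesis
    by (simp only: distrib_left sum.distrib) simp
qed

subsection \<open>Chains of derivatives\<close>

lemma quot01_defined_shift:
  assumes "\<And>i. i \<in> {1..N} \<Longrightarrow> \<nu> + of_nat i \<noteq> 0" "l \<le> N"
  shows "quot01_defined \<nu> (\<nu> + of_nat l)"
  using assms by (cases "l = 0") (auto simp: quot01_defined_def)

lemma quot01_mult:
  assumes "quot01_defined a b"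
  shows "quot01 a b * b = a"
  using assms by (auto simp: quot01_def quot01_defined_def)

lemma C_diff_on_has_field_derivative:
  assumes "C_diff_on N h D" "i < N" "z \<in> D"
  shows "((deriv ^^ i) h has_field_derivative (deriv ^^ Suc i) h z) (at z)"
  using assms by (simp add: C_diff_on_def field_differentiable_derivI)

lemma higher_deriv_Suc_eq:
  assumes "open D" "z \<in> D" "\<And>w. w \<in> D \<Longrightarrow> (deriv ^^ i) h w = e w"
    and "(e has_field_derivative d) (at z)"
  shows "(deriv ^^ Suc i) h z = d"
proof -
  have "((deriv ^^ i) h has_field_derivative d) (at z)"
    by (rule has_field_derivative_transform_within_open [OF assms(4,1,2)]) (simp add: assms(3))
  then show ?thesis by (simp add: DERIV_imp_deriv)
qed

text \<open>One abstract chain serves all eight formulas: \<open>\<sigma>\<close> is the sign of a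
  step down and \<open>\<tau>\<close> that of a step up. Steps and smoothness are postulated only
  where the quotient is defined, in agreement with the hypotheses on \<open>p_fun\<close> and
  \<open>q_fun\<close>.\<close>

locale derivative_chain =
  fixes D :: "complex set" and \<mu> \<sigma> \<tau> :: complex and \<Phi> r :: "nat \<Rightarrow> complex \<Rightarrow> complex" and n :: nat
  assumes open_D: "open D"
    and step: "\<And>l z. z \<in> D \<Longrightarrow> quot01_defined \<mu> (\<mu> + of_nat l) \<Longrightarrow>
      (\<Phi> l has_field_derivative
         \<sigma> * down_weight \<mu> l * \<Phi> (l - 1) z + \<tau> * up_weight \<mu> l * \<Phi> (l + 1) z + r l z) (at z)"
    and smooth: "\<And>l. l \<le> 2 * n \<Longrightarrow> quot01_defined \<mu> (\<mu> + of_nat l) \<Longrightarrow> C_diff_on (2 * n) (r l) D"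
begin

text \<open>A term \<open>\<Phi> l\<close> of the \<open>m\<close>-th derivative collects all walks of \<open>m\<close> steps from \<open>0\<close> to \<open>l\<close>; each
  contains \<open>(m + l) / 2\<close> steps up and \<open>(m - l) / 2\<close> steps down.\<close>

definition even_coeff :: "nat \<Rightarrow> nat \<Rightarrow> complex" where
  "even_coeff k m = \<tau> ^ (m + k) * \<sigma> ^ (m - k) * A_coeff k m \<mu>"

definition odd_coeff :: "nat \<Rightarrow> nat \<Rightarrow> complex" where
  "odd_coeff k m = \<tau> ^ (m + k + 1) * \<sigma> ^ (m - k) * B_coeff k m \<mu>"

lemma sum_even_coeff_step:
  assumes "\<And>l. l \<in> {1..2 * m} \<Longrightarrow> \<mu> + of_nat l \<noteq> 0"
  shows "(\<Sum>k\<le>m. even_coeff k m * (\<sigma> * down_weight \<mu> (2 * k) * y (2 * k - 1) + \<tau> * up_weight \<mu> (2 * k) * y (2 * k + 1)))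
       = (\<Sum>k\<le>m. odd_coeff k m * y (2 * k + 1))"
proof -
  \<comment> \<open>For odd \<open>l\<close> the exponents count the steps up and down of a walk of
    2m+1 steps from 0 to \<open>l\<close>, so the signs are absorbed into the sequence.\<close>
  define x where "x l = \<tau> ^ (m + (l + 1) div 2) * \<sigma> ^ (m + 1 - (l + 1) div 2) * y l" for l
  have "even_coeff k m * (\<sigma> * down_weight \<mu> (2 * k) * y (2 * k - 1) + \<tau> * up_weight \<mu> (2 * k) * y (2 * k + 1))
      = A_coeff k m \<mu> * (down_weight \<mu> (2 * k) * x (2 * k - 1) + up_weight \<mu> (2 * k) * x (2 * k + 1))"
    if "k \<le> m" for k
    using that by (cases "k = 0") (simp_all add: even_coeff_def x_def Suc_diff_le algebra_simps)
  moreover have "B_coeff k m \<mu> * x (2 * k + 1) = odd_coeff k m * y (2 * k + 1)" if "k \<le> m" for k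
    using that by (simp add: odd_coeff_def x_def mult_ac)
  ultimately show ?thesis
    using sum_A_coeff_step [of m \<mu> x] assms by simp
qed

lemma sum_odd_coeff_step:
  assumes "\<And>l. l \<in> {1..2 * m + 1} \<Longrightarrow> \<mu> + of_nat l \<noteq> 0"
  shows "(\<Sum>k\<le>m. odd_coeff k m * (\<sigma> * down_weight \<mu> (2 * k + 1) * y (2 * k) + \<tau> * up_weight \<mu> (2 * k + 1) * y (2 * k + 2)))
       = (\<Sum>k\<le>Suc m. even_coeff k (Suc m) * y (2 * k))"
proof -
  \<comment> \<open>The same count for even \<open>l\<close> and walks of 2m+2 steps.\<close>
  define x where "x l = \<tau> ^ (m + 1 + l div 2) * \<sigma> ^ (m + 1 - l div 2) * y l" for l
  have "odd_coeff k m * (\<sigma> * down_weight \<mu> (2 * k + 1) * y (2 * k) + \<tau> * up_weight \<mu> (2 * k + 1) * y (2 * k + 2))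
      = B_coeff k m \<mu> * (down_weight \<mu> (2 * k + 1) * x (2 * k) + up_weight \<mu> (2 * k + 1) * x (2 * k + 2))"
    if "k \<le> m" for k
    using that by (simp add: odd_coeff_def x_def Suc_diff_le algebra_simps)
  moreover have "A_coeff k (Suc m) \<mu> * x (2 * k) = even_coeff k (Suc m) * y (2 * k)" for k
    by (simp add: even_coeff_def x_def mult_ac)
  ultimately show ?thesis
    using sum_B_coeff_step [of m \<mu> x] assms by simp
qed

lemma deriv_r:
  assumes "\<And>i. i \<in> {1..N} \<Longrightarrow> \<mu> + of_nat i \<noteq> 0" "l \<le> N" "l \<le> 2 * n" "i < 2 * n" "z \<in> D"
  shows "((deriv ^^ i) (r l) has_field_derivative (deriv ^^ Suc i) (r l) z) (at z)"
  using assms by (intro C_diff_on_has_field_derivative [OF smooth] quot01_defined_shift [of N])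

text \<open>A remainder \<open>r (2 * k)\<close> arises when the derivative of order 2j is
  differentiated, and then undergoes 2m-2j-1 further differentiations. A remainder
  \<open>r (2 * k + 1)\<close> arises one order later, so one differentiation fewer acts on
  it.\<close>

definition even_sum :: "nat \<Rightarrow> complex \<Rightarrow> complex" where
  "even_sum m z = (\<Sum>k\<le>m. even_coeff k m * \<Phi> (2 * k) z)
     + (\<Sum>j<m. \<Sum>k\<le>j. even_coeff k j * (deriv ^^ (2 * m - 2 * j - 1)) (r (2 * k)) z)
     + (\<Sum>j<m. \<Sum>k\<le>j. odd_coeff k j * (deriv ^^ (2 * m - 2 * j - 2)) (r (2 * k + 1)) z)"

text \<open>The sum over even indices now includes j = m: the last differentiation has just produced
  these remainders, in undifferentiated form.\<close>

definition odd_sum :: "nat \<Rightarrow> complex \<Rightarrow> complex" where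
  "odd_sum m z = (\<Sum>k\<le>m. odd_coeff k m * \<Phi> (2 * k + 1) z)
     + (\<Sum>j\<le>m. \<Sum>k\<le>j. even_coeff k j * (deriv ^^ (2 * m - 2 * j)) (r (2 * k)) z)
     + (\<Sum>j<m. \<Sum>k\<le>j. odd_coeff k j * (deriv ^^ (2 * m - 2 * j - 1)) (r (2 * k + 1)) z)"

lemma even_sum_deriv:
  assumes nz: "\<And>l. l \<in> {1..2 * m} \<Longrightarrow> \<mu> + of_nat l \<noteq> 0" and "m \<le> n" "z \<in> D"
  shows "(even_sum m has_field_derivative odd_sum m z) (at z)"
proof -
  have defd: "quot01_defined \<mu> (\<mu> + of_nat l)" if "l \<le> 2 * m" for l
    using quot01_defined_shift [OF nz that] .
  have "((\<lambda>w. \<Sum>k\<le>m. even_coeff k m * \<Phi> (2 * k) w) has_field_derivative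
      (\<Sum>k\<le>m. even_coeff k m * (\<sigma> * down_weight \<mu> (2 * k) * \<Phi> (2 * k - 1) z
        + \<tau> * up_weight \<mu> (2 * k) * \<Phi> (2 * k + 1) z + r (2 * k) z))) (at z)"
    using \<open>z \<in> D\<close> by (intro DERIV_sum DERIV_cmult step defd) auto
  also have "(\<Sum>k\<le>m. even_coeff k m * (\<sigma> * down_weight \<mu> (2 * k) * \<Phi> (2 * k - 1) z
        + \<tau> * up_weight \<mu> (2 * k) * \<Phi> (2 * k + 1) z + r (2 * k) z))
      = (\<Sum>k\<le>m. odd_coeff k m * \<Phi> (2 * k + 1) z) + (\<Sum>k\<le>m. even_coeff k m * r (2 * k) z)"
    unfolding distrib_left [of _ _ "r _ z"] sum.distrib
    using sum_even_coeff_step [OF nz, of m "\<lambda>l. \<Phi> l z"] by simp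
  finally have 1: "((\<lambda>w. \<Sum>k\<le>m. even_coeff k m * \<Phi> (2 * k) w) has_field_derivative
      (\<Sum>k\<le>m. odd_coeff k m * \<Phi> (2 * k + 1) z) + (\<Sum>k\<le>m. even_coeff k m * r (2 * k) z)) (at z)" .
  have 2: "((\<lambda>w. \<Sum>j<m. \<Sum>k\<le>j. even_coeff k j * (deriv ^^ (2 * m - 2 * j - 1)) (r (2 * k)) w) has_field_derivative
      (\<Sum>j<m. \<Sum>k\<le>j. even_coeff k j * (deriv ^^ Suc (2 * m - 2 * j - 1)) (r (2 * k)) z)) (at z)"
    using assms by (intro DERIV_sum DERIV_cmult deriv_r [of "2 * m"]) auto
  have 3: "((\<lambda>w. \<Sum>j<m. \<Sum>k\<le>j. odd_coeff k j * (deriv ^^ (2 * m - 2 * j - 2)) (r (2 * k + 1)) w) has_field_derivative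
      (\<Sum>j<m. \<Sum>k\<le>j. odd_coeff k j * (deriv ^^ Suc (2 * m - 2 * j - 2)) (r (2 * k + 1)) z)) (at z)"
    using assms by (intro DERIV_sum DERIV_cmult deriv_r [of "2 * m"]) auto
  \<comment> \<open>The remainders just produced form the summand j = m, of order 0.\<close>
  have 4: "(\<Sum>j<m. \<Sum>k\<le>j. even_coeff k j * (deriv ^^ Suc (2 * m - 2 * j - 1)) (r (2 * k)) z)
      + (\<Sum>k\<le>m. even_coeff k m * r (2 * k) z)
      = (\<Sum>j\<le>m. \<Sum>k\<le>j. even_coeff k j * (deriv ^^ (2 * m - 2 * j)) (r (2 * k)) z)"
    unfolding lessThan_Suc_atMost [of m, symmetric] sum.lessThan_Suc
    by (simp add: Suc_diff_Suc del: funpow.simps cong: sum.cong_simp)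
  have 5: "(\<Sum>j<m. \<Sum>k\<le>j. odd_coeff k j * (deriv ^^ Suc (2 * m - 2 * j - 2)) (r (2 * k + 1)) z)
      = (\<Sum>j<m. \<Sum>k\<le>j. odd_coeff k j * (deriv ^^ (2 * m - 2 * j - 1)) (r (2 * k + 1)) z)"
  proof (rule sum.cong [OF refl])
    fix j assume "j \<in> {..<m}"
    then have "Suc (2 * m - 2 * j - 2) = 2 * m - 2 * j - 1" by auto
    then show "(\<Sum>k\<le>j. odd_coeff k j * (deriv ^^ Suc (2 * m - 2 * j - 2)) (r (2 * k + 1)) z)
      = (\<Sum>k\<le>j. odd_coeff k j * (deriv ^^ (2 * m - 2 * j - 1)) (r (2 * k + 1)) z)" by metis
  qed
  show ?thesis
    using DERIV_add [OF DERIV_add [OF 1 2] 3]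
    unfolding even_sum_def [abs_def] odd_sum_def 4 [symmetric] 5 by (simp add: add_ac)
qed

text \<open>\<open>odd_sum m\<close> contains remainders of order up to 2m that must be
  differentiated once more, whence the strict bound on m. In \<open>even_sum m\<close> the highest
  order is 2m-1, so there m = n is still within \<open>C_diff_on (2 * n)\<close>.\<close>

lemma odd_sum_deriv:
  assumes nz: "\<And>l. l \<in> {1..2 * m + 1} \<Longrightarrow> \<mu> + of_nat l \<noteq> 0" and "m < n" "z \<in> D"
  shows "(odd_sum m has_field_derivative even_sum (Suc m) z) (at z)"
proof -
  have defd: "quot01_defined \<mu> (\<mu> + of_nat l)" if "l \<le> 2 * m + 1" for l
    using quot01_defined_shift [OF nz that] .
  have "((\<lambda>w. \<Sum>k\<le>m. odd_coeff k m * \<Phi> (2 * k + 1) w) has_field_derivative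
      (\<Sum>k\<le>m. odd_coeff k m * (\<sigma> * down_weight \<mu> (2 * k + 1) * \<Phi> (2 * k + 1 - 1) z
        + \<tau> * up_weight \<mu> (2 * k + 1) * \<Phi> (2 * k + 1 + 1) z + r (2 * k + 1) z))) (at z)"
    using \<open>z \<in> D\<close> by (intro DERIV_sum DERIV_cmult step defd) auto
  also have "(\<Sum>k\<le>m. odd_coeff k m * (\<sigma> * down_weight \<mu> (2 * k + 1) * \<Phi> (2 * k + 1 - 1) z
        + \<tau> * up_weight \<mu> (2 * k + 1) * \<Phi> (2 * k + 1 + 1) z + r (2 * k + 1) z))
      = (\<Sum>k\<le>Suc m. even_coeff k (Suc m) * \<Phi> (2 * k) z) + (\<Sum>k\<le>m. odd_coeff k m * r (2 * k + 1) z)"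
    unfolding distrib_left [of _ _ "r _ z"] sum.distrib
    using sum_odd_coeff_step [OF nz, of m "\<lambda>l. \<Phi> l z"] by simp
  finally have 1: "((\<lambda>w. \<Sum>k\<le>m. odd_coeff k m * \<Phi> (2 * k + 1) w) has_field_derivative
      (\<Sum>k\<le>Suc m. even_coeff k (Suc m) * \<Phi> (2 * k) z) + (\<Sum>k\<le>m. odd_coeff k m * r (2 * k + 1) z)) (at z)" .
  have 2: "((\<lambda>w. \<Sum>j\<le>m. \<Sum>k\<le>j. even_coeff k j * (deriv ^^ (2 * m - 2 * j)) (r (2 * k)) w) has_field_derivative
      (\<Sum>j\<le>m. \<Sum>k\<le>j. even_coeff k j * (deriv ^^ Suc (2 * m - 2 * j)) (r (2 * k)) z)) (at z)"
    using assms by (intro DERIV_sum DERIV_cmult deriv_r [of "2 * m + 1"]) auto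
  have 3: "((\<lambda>w. \<Sum>j<m. \<Sum>k\<le>j. odd_coeff k j * (deriv ^^ (2 * m - 2 * j - 1)) (r (2 * k + 1)) w) has_field_derivative
      (\<Sum>j<m. \<Sum>k\<le>j. odd_coeff k j * (deriv ^^ Suc (2 * m - 2 * j - 1)) (r (2 * k + 1)) z)) (at z)"
    using assms by (intro DERIV_sum DERIV_cmult deriv_r [of "2 * m + 1"]) auto
  have 4: "(\<Sum>j\<le>m. \<Sum>k\<le>j. even_coeff k j * (deriv ^^ Suc (2 * m - 2 * j)) (r (2 * k)) z)
      = (\<Sum>j<Suc m. \<Sum>k\<le>j. even_coeff k j * (deriv ^^ (2 * Suc m - 2 * j - 1)) (r (2 * k)) z)"
    unfolding lessThan_Suc_atMost
  proof (rule sum.cong [OF refl])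
    fix j assume "j \<in> {..m}"
    then have "Suc (2 * m - 2 * j) = 2 * Suc m - 2 * j - 1" by auto
    then show "(\<Sum>k\<le>j. even_coeff k j * (deriv ^^ Suc (2 * m - 2 * j)) (r (2 * k)) z)
      = (\<Sum>k\<le>j. even_coeff k j * (deriv ^^ (2 * Suc m - 2 * j - 1)) (r (2 * k)) z)" by metis
  qed
  \<comment> \<open>Here the new remainders have odd index and supply the summand j = m.\<close>
  have 5: "(\<Sum>j<m. \<Sum>k\<le>j. odd_coeff k j * (deriv ^^ Suc (2 * m - 2 * j - 1)) (r (2 * k + 1)) z)
      + (\<Sum>k\<le>m. odd_coeff k m * r (2 * k + 1) z)
      = (\<Sum>j<Suc m. \<Sum>k\<le>j. odd_coeff k j * (deriv ^^ (2 * Suc m - 2 * j - 2)) (r (2 * k + 1)) z)"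
    unfolding sum.lessThan_Suc
    by (simp add: Suc_diff_Suc del: funpow.simps cong: sum.cong_simp)
  show ?thesis
    using DERIV_add [OF DERIV_add [OF 1 2] 3]
    unfolding even_sum_def odd_sum_def [abs_def] 4 5 [symmetric] by (simp only: add_ac)
qed

text \<open>Both parities are proved together, since each order is obtained by differentiating the
  previous one on the open set. Each further differentiation adds one index to the nonvanishing
  condition, which explains the ranges ending at 2m-1 and 2m.\<close>

lemma higher_deriv_eq:
  "m \<le> n \<Longrightarrow> (\<And>l. l \<in> {1..2 * m - 1} \<Longrightarrow> \<mu> + of_nat l \<noteq> 0) \<Longrightarrow> z \<in> D \<Longrightarrow>
     (deriv ^^ (2 * m)) (\<Phi> 0) z = even_sum m z"
  "m \<le> n \<Longrightarrow> (\<And>l. l \<in> {1..2 * m} \<Longrightarrow> \<mu> + of_nat l \<noteq> 0) \<Longrightarrow> z \<in> D \<Longrightarrow>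
     (deriv ^^ (2 * m + 1)) (\<Phi> 0) z = odd_sum m z"
proof (induction m arbitrary: z)
  case 0
  have "even_sum 0 = \<Phi> 0"
    by (simp add: even_sum_def fun_eq_iff even_coeff_def A_coeff_def)
  {
    case 1
    then show ?case using \<open>even_sum 0 = \<Phi> 0\<close> by simp
  next
    case 2
    then show ?case
      using even_sum_deriv [of 0 z] \<open>even_sum 0 = \<Phi> 0\<close> by (simp add: DERIV_imp_deriv)
  }
next
  case (Suc m)
  \<comment> \<open>Stated before the case split because the odd order of the same
    \<open>Suc m\<close> is obtained from it.\<close>
  have even: "(deriv ^^ (2 * Suc m)) (\<Phi> 0) w = even_sum (Suc m) w"
    if "Suc m \<le> n" "w \<in> D" and nz: "\<And>l. l \<in> {1..2 * Suc m - 1} \<Longrightarrow> \<mu> + of_nat l \<noteq> 0" for w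
  proof -
    have "(deriv ^^ Suc (2 * m + 1)) (\<Phi> 0) w = even_sum (Suc m) w"
      using that by (intro higher_deriv_Suc_eq [OF open_D \<open>w \<in> D\<close> Suc.IH(2)] odd_sum_deriv) auto
    then show ?thesis by simp
  qed
  {
    case 1
    then show ?case by (intro even)
  next
    case 2
    then have "(deriv ^^ Suc (2 * Suc m)) (\<Phi> 0) z = odd_sum (Suc m) z"
      by (intro higher_deriv_Suc_eq [OF open_D _ even] even_sum_deriv) auto
    then show ?case by simp
  }
qed

end

subsection \<open>The families \<open>F\<close> and \<open>G\<close>\<close>

lemma log_branch_on_nonzero:
  assumes "log_branch_on L D" "z \<in> D"
  shows "z \<noteq> 0"
  using assms exp_not_eq_zero by (metis log_branch_on_def)

text \<open>Continuity of \<open>L\<close> suffices: as a continuous inverse of exp, whose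
  derivative never vanishes, it is differentiable with derivative 1/z.\<close>

lemma branch_pow_has_field_derivative:
  assumes "log_branch_on L D" "z \<in> D"
  shows "((\<lambda>w. branch_pow L w \<nu>) has_field_derivative \<nu> / z * branch_pow L z \<nu>) (at z)"
proof -
  have L: "open D" "continuous_on D L" "\<And>w. w \<in> D \<Longrightarrow> exp (L w) = w"
    using assms(1) by (auto simp: log_branch_on_def)
  have "(L has_field_derivative inverse (exp (L z))) (at z)"
    using L assms(2) DERIV_exp [of "L z"] log_branch_on_nonzero [OF assms]
    by (intro has_field_derivative_inverse_basic [where f = exp and t = D])
      (auto simp: continuous_on_eq_continuous_at)
  then show ?thesis
    unfolding branch_pow_def using L(3) [OF assms(2)]
    by (auto intro!: derivative_eq_intros simp: field_simps)
qed

lemma branch_pow_nonzero [simp]: "branch_pow L z \<nu> \<noteq> 0"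
  by (simp add: branch_pow_def)

text \<open>The power is factored out so that the remaining expression is the left-hand side of
  \<open>recurrence_elim\<close>.\<close>

lemma has_field_derivative_div_branch_pow:
  assumes "log_branch_on L D" "z \<in> D" "(h has_field_derivative h') (at z)"
  shows "((\<lambda>w. h w / branch_pow L w \<nu>) has_field_derivative (h' - \<nu> / z * h z) / branch_pow L z \<nu>) (at z)"
  by (rule derivative_eq_intros branch_pow_has_field_derivative assms refl)+
    (use log_branch_on_nonzero [OF assms(1,2)] in \<open>auto simp: field_simps\<close>)

lemma has_field_derivative_branch_pow_mult:
  assumes "log_branch_on L D" "z \<in> D" "(h has_field_derivative h') (at z)"
  shows "((\<lambda>w. branch_pow L w \<nu> * h w) has_field_derivative branch_pow L z \<nu> * (h' + \<nu> / z * h z)) (at z)"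
  by (rule derivative_eq_intros branch_pow_has_field_derivative assms refl)+
    (simp add: algebra_simps)

text \<open>The second recurrence of a family is used to eliminate \<open>h\<close>, the first to eliminate its derivative;
  \<open>e = 1\<close> for \<open>F\<close> and \<open>e = - 1\<close> for \<open>G\<close>.\<close>

lemma recurrence_elim:
  fixes hm hp h h' f g z \<mu> \<nu> e :: complex
  assumes "hm + e * hp = 2 * h' + f" "hm - e * hp = 2 * \<mu> / z * h + g" "quot01_defined \<nu> \<mu>"
  shows "h' - \<nu> / z * h =
      (1 - quot01 \<nu> \<mu>) / 2 * hm + e * ((1 + quot01 \<nu> \<mu>) / 2) * hp + (quot01 \<nu> \<mu> / 2 * g - f / 2)"
    and "h' + \<nu> / z * h =
      (1 + quot01 \<nu> \<mu>) / 2 * hm + e * ((1 - quot01 \<nu> \<mu>) / 2) * hp + (- (quot01 \<nu> \<mu> / 2 * g) - f / 2)"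
proof -
  define c where "c = quot01 \<nu> \<mu>"
  \<comment> \<open>This uses \<open>c * \<mu> = \<nu>\<close>, which survives
    \<open>\<mu> = 0\<close> because definedness then forces \<open>\<nu> = 0\<close>.\<close>
  have "\<nu> / z * h = c * (\<mu> / z * h)"
    using quot01_mult [OF assms(3)] by (simp add: c_def)
  also have "\<mu> / z * h = (hm - e * hp - g) / 2"
    using assms(2) by (simp add: field_simps)
  finally have h: "\<nu> / z * h = c * ((hm - e * hp - g) / 2)" .
  have h': "h' = (hm + e * hp - f) / 2"
    using assms(1) by (simp add: field_simps)
  show "h' - \<nu> / z * h =
      (1 - quot01 \<nu> \<mu>) / 2 * hm + e * ((1 + quot01 \<nu> \<mu>) / 2) * hp + (quot01 \<nu> \<mu> / 2 * g - f / 2)"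
    unfolding h unfolding h' c_def [symmetric] by (simp add: field_simps)
  show "h' + \<nu> / z * h =
      (1 + quot01 \<nu> \<mu>) / 2 * hm + e * ((1 - quot01 \<nu> \<mu>) / 2) * hp + (- (quot01 \<nu> \<mu> / 2 * g) - f / 2)"
    unfolding h unfolding h' c_def [symmetric] by (simp add: field_simps)
qed

lemma derivative_chain_p:
  assumes branch: "log_branch_on L D"
    and smooth: "\<And>l. l \<in> {0..2 * n} \<Longrightarrow> quot01_defined \<nu> (\<nu> + of_nat l) \<Longrightarrow>
                     C_diff_on (2 * n) (p_fun L f g \<nu> l) D"
    and rec: "\<And>\<mu> z. z \<in> D \<Longrightarrow> H \<mu> field_differentiable at z \<and>
        H (\<mu> - 1) z + e * H (\<mu> + 1) z = 2 * deriv (H \<mu>) z + f \<mu> z \<and>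
        H (\<mu> - 1) z - e * H (\<mu> + 1) z = 2 * \<mu> / z * H \<mu> z + g \<mu> z"
  shows "derivative_chain D \<nu> 1 e (\<lambda>l w. H (\<nu> + of_nat l) w / branch_pow L w \<nu>) (p_fun L f g \<nu>) n"
proof
  show "open D" using branch by (simp add: log_branch_on_def)
next
  fix l z assume z: "z \<in> D" and "quot01_defined \<nu> (\<nu> + of_nat l)"
  \<comment> \<open>At \<open>l = 0\<close> the two functions differ, but both are multiplied by
    weight 0.\<close>
  have pred: "down_weight \<nu> l * H (\<nu> + of_nat (l - 1)) z = down_weight \<nu> l * H (\<nu> + of_nat l - 1) z"
    by (cases l) simp_all
  have "((\<lambda>w. H (\<nu> + of_nat l) w / branch_pow L w \<nu>) has_field_derivative
      (deriv (H (\<nu> + of_nat l)) z - \<nu> / z * H (\<nu> + of_nat l) z) / branch_pow L z \<nu>) (at z)"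
    using rec [OF z]
    by (intro has_field_derivative_div_branch_pow [OF branch z] field_differentiable_derivI) blast
  also have "deriv (H (\<nu> + of_nat l)) z - \<nu> / z * H (\<nu> + of_nat l) z
      = down_weight \<nu> l * H (\<nu> + of_nat l - 1) z + e * up_weight \<nu> l * H (\<nu> + of_nat l + 1) z
        + (quot01 \<nu> (\<nu> + of_nat l) / 2 * g (\<nu> + of_nat l) z - f (\<nu> + of_nat l) z / 2)"
    unfolding down_weight_def up_weight_def
    using rec [OF z] \<open>quot01_defined _ _\<close> by (intro recurrence_elim(1)) blast+
  also have "\<dots> / branch_pow L z \<nu> =
      1 * down_weight \<nu> l * (H (\<nu> + of_nat (l - 1)) z / branch_pow L z \<nu>)
      + e * up_weight \<nu> l * (H (\<nu> + of_nat (l + 1)) z / branch_pow L z \<nu>) + p_fun L f g \<nu> l z"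
    unfolding p_fun_def pred [symmetric] by (simp add: add_divide_distrib diff_divide_distrib add_ac)
  finally show "((\<lambda>w. H (\<nu> + of_nat l) w / branch_pow L w \<nu>) has_field_derivative
      1 * down_weight \<nu> l * (H (\<nu> + of_nat (l - 1)) z / branch_pow L z \<nu>)
      + e * up_weight \<nu> l * (H (\<nu> + of_nat (l + 1)) z / branch_pow L z \<nu>) + p_fun L f g \<nu> l z) (at z)" .
qed (simp add: smooth)

text \<open>Raising \<open>l\<close> lowers the order \<nu>-l, so the upper neighbour in the
  recurrences of \<open>H\<close> is now reached by a step down. Hence \<open>e\<close> becomes the
  sign \<open>\<sigma>\<close> instead of \<open>\<tau>\<close>.\<close>

lemma derivative_chain_q:
  assumes branch: "log_branch_on L D"
    and smooth: "\<And>l. l \<in> {0..2 * n} \<Longrightarrow> quot01_defined \<nu> (\<nu> - of_nat l) \<Longrightarrow>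
                     C_diff_on (2 * n) (q_fun L f g \<nu> l) D"
    and rec: "\<And>\<mu> z. z \<in> D \<Longrightarrow> H \<mu> field_differentiable at z \<and>
        H (\<mu> - 1) z + e * H (\<mu> + 1) z = 2 * deriv (H \<mu>) z + f \<mu> z \<and>
        H (\<mu> - 1) z - e * H (\<mu> + 1) z = 2 * \<mu> / z * H \<mu> z + g \<mu> z"
  shows "derivative_chain D (- \<nu>) e 1 (\<lambda>l w. branch_pow L w \<nu> * H (\<nu> - of_nat l) w) (q_fun L f g \<nu>) n"
proof
  show "open D" using branch by (simp add: log_branch_on_def)
next
  have defd: "quot01_defined (- \<nu>) (- \<nu> + of_nat l) \<longleftrightarrow> quot01_defined \<nu> (\<nu> - of_nat l)" for l
    by (auto simp: quot01_defined_def)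
  show "C_diff_on (2 * n) (q_fun L f g \<nu> l) D"
    if "l \<le> 2 * n" "quot01_defined (- \<nu>) (- \<nu> + of_nat l)" for l
    using that unfolding defd by (intro smooth) auto
  fix l z assume z: "z \<in> D" and "quot01_defined (- \<nu>) (- \<nu> + of_nat l)"
  then have "quot01_defined \<nu> (\<nu> - of_nat l)" by (simp only: defd)
  \<comment> \<open>Negating both arguments keeps the quotient, which identifies the weights at
    -\<nu> with the factors that occur in \<open>q_fun\<close>.\<close>
  have "quot01 (- \<nu>) (- \<nu> + of_nat l) = quot01 \<nu> (\<nu> - of_nat l)"
    using quot01_minus [of \<nu> "\<nu> - of_nat l"] by simp
  then have weights: "up_weight (- \<nu>) l = (1 + quot01 \<nu> (\<nu> - of_nat l)) / 2"
      "down_weight (- \<nu>) l = (1 - quot01 \<nu> (\<nu> - of_nat l)) / 2"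
    by (simp_all add: up_weight_def down_weight_def)
  have pred: "down_weight (- \<nu>) l * H (\<nu> - of_nat (l - 1)) z = down_weight (- \<nu>) l * H (\<nu> - of_nat l + 1) z"
    by (cases l) simp_all
  have "((\<lambda>w. branch_pow L w \<nu> * H (\<nu> - of_nat l) w) has_field_derivative
      branch_pow L z \<nu> * (deriv (H (\<nu> - of_nat l)) z + \<nu> / z * H (\<nu> - of_nat l) z)) (at z)"
    using rec [OF z]
    by (intro has_field_derivative_branch_pow_mult [OF branch z] field_differentiable_derivI) blast
  also have "deriv (H (\<nu> - of_nat l)) z + \<nu> / z * H (\<nu> - of_nat l) z
      = up_weight (- \<nu>) l * H (\<nu> - of_nat l - 1) z + e * down_weight (- \<nu>) l * H (\<nu> - of_nat l + 1) z
        + (- (quot01 \<nu> (\<nu> - of_nat l) / 2 * g (\<nu> - of_nat l) z) - f (\<nu> - of_nat l) z / 2)"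
    unfolding weights
    using rec [OF z] \<open>quot01_defined \<nu> _\<close> by (intro recurrence_elim(2)) blast+
  also have "branch_pow L z \<nu> * \<dots> =
      e * down_weight (- \<nu>) l * (branch_pow L z \<nu> * H (\<nu> - of_nat (l - 1)) z)
      + 1 * up_weight (- \<nu>) l * (branch_pow L z \<nu> * H (\<nu> - of_nat (l + 1)) z) + q_fun L f g \<nu> l z"
    unfolding q_fun_def mult.assoc [of e] pred [symmetric] mult.left_commute [of "down_weight _ _"]
    by (simp add: algebra_simps)
  finally show "((\<lambda>w. branch_pow L w \<nu> * H (\<nu> - of_nat l) w) has_field_derivative
      e * down_weight (- \<nu>) l * (branch_pow L z \<nu> * H (\<nu> - of_nat (l - 1)) z)
      + 1 * up_weight (- \<nu>) l * (branch_pow L z \<nu> * H (\<nu> - of_nat (l + 1)) z) + q_fun L f g \<nu> l z) (at z)" .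
qed

text \<open>The exponents differ by 2k. This turns the count of steps down into the sign as stated;
  the premise has the form that congruence for sums provides.\<close>

lemma power_minus_one_diff:
  assumes "k \<in> {..j}"
  shows "(- 1 :: complex) ^ (j - k) = (- 1) ^ (k + j)"
  using assms by (auto simp: le_iff_add power_add)

theorem theorem3p1:
  fixes L :: "complex \<Rightarrow> complex" and D :: "complex set"
    and f g F G :: "complex \<Rightarrow> complex \<Rightarrow> complex"
    and n :: nat and \<nu> :: complex
  assumes branch: "log_branch_on L D"
    and p_smooth: "\<And>l. l \<in> {0..2 * n} \<Longrightarrow> quot01_defined \<nu> (\<nu> + of_nat l) \<Longrightarrow>
                     C_diff_on (2 * n) (p_fun L f g \<nu> l) D"
    and q_smooth: "\<And>l. l \<in> {0..2 * n} \<Longrightarrow> quot01_defined \<nu> (\<nu> - of_nat l) \<Longrightarrow>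
                     C_diff_on (2 * n) (q_fun L f g \<nu> l) D"
  shows
    "(F_family D f g F \<longrightarrow>
        (\<nu> \<notin> uminus ` pos_upto (2 * n - 1) \<longrightarrow> (\<forall>z\<in>D.
          (deriv ^^ (2 * n)) (\<lambda>w. F \<nu> w / branch_pow L w \<nu>) z =
            (\<Sum>k\<le>n. A_coeff k n \<nu> * (F (\<nu> + 2 * of_nat k) z / branch_pow L z \<nu>))
            + (\<Sum>j<n. \<Sum>k\<le>j. A_coeff k j \<nu> * (deriv ^^ (2 * n - 2 * j - 1)) (p_fun L f g \<nu> (2 * k)) z)
            + (\<Sum>j<n. \<Sum>k\<le>j. B_coeff k j \<nu> * (deriv ^^ (2 * n - 2 * j - 2)) (p_fun L f g \<nu> (2 * k + 1)) z))) \<and>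
        (\<nu> \<notin> uminus ` pos_upto (2 * n) \<longrightarrow> (\<forall>z\<in>D.
          (deriv ^^ (2 * n + 1)) (\<lambda>w. F \<nu> w / branch_pow L w \<nu>) z =
            (\<Sum>k\<le>n. B_coeff k n \<nu> * (F (\<nu> + 2 * of_nat k + 1) z / branch_pow L z \<nu>))
            + (\<Sum>j\<le>n. \<Sum>k\<le>j. A_coeff k j \<nu> * (deriv ^^ (2 * n - 2 * j)) (p_fun L f g \<nu> (2 * k)) z)
            + (\<Sum>j<n. \<Sum>k\<le>j. B_coeff k j \<nu> * (deriv ^^ (2 * n - 2 * j - 1)) (p_fun L f g \<nu> (2 * k + 1)) z))) \<and>
        (\<nu> \<notin> pos_upto (2 * n - 1) \<longrightarrow> (\<forall>z\<in>D.
          (deriv ^^ (2 * n)) (\<lambda>w. branch_pow L w \<nu> * F \<nu> w) z =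
            (\<Sum>k\<le>n. A_coeff k n (- \<nu>) * branch_pow L z \<nu> * F (\<nu> - 2 * of_nat k) z)
            + (\<Sum>j<n. \<Sum>k\<le>j. A_coeff k j (- \<nu>) * (deriv ^^ (2 * n - 2 * j - 1)) (q_fun L f g \<nu> (2 * k)) z)
            + (\<Sum>j<n. \<Sum>k\<le>j. B_coeff k j (- \<nu>) * (deriv ^^ (2 * n - 2 * j - 2)) (q_fun L f g \<nu> (2 * k + 1)) z))) \<and>
        (\<nu> \<notin> pos_upto (2 * n) \<longrightarrow> (\<forall>z\<in>D.
          (deriv ^^ (2 * n + 1)) (\<lambda>w. branch_pow L w \<nu> * F \<nu> w) z =
            (\<Sum>k\<le>n. B_coeff k n (- \<nu>) * branch_pow L z \<nu> * F (\<nu> - 2 * of_nat k - 1) z)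
            + (\<Sum>j\<le>n. \<Sum>k\<le>j. A_coeff k j (- \<nu>) * (deriv ^^ (2 * n - 2 * j)) (q_fun L f g \<nu> (2 * k)) z)
            + (\<Sum>j<n. \<Sum>k\<le>j. B_coeff k j (- \<nu>) * (deriv ^^ (2 * n - 2 * j - 1)) (q_fun L f g \<nu> (2 * k + 1)) z)))) \<and>
     (G_family D f g G \<longrightarrow>
        (\<nu> \<notin> uminus ` pos_upto (2 * n - 1) \<longrightarrow> (\<forall>z\<in>D.
          (deriv ^^ (2 * n)) (\<lambda>w. G \<nu> w / branch_pow L w \<nu>) z =
            (\<Sum>k\<le>n. (-1) ^ (n + k) * A_coeff k n \<nu> * (G (\<nu> + 2 * of_nat k) z / branch_pow L z \<nu>))
            + (\<Sum>j<n. \<Sum>k\<le>j. (-1) ^ (k + j) * A_coeff k j \<nu> * (deriv ^^ (2 * n - 2 * j - 1)) (p_fun L f g \<nu> (2 * k)) z)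
            + (\<Sum>j<n. \<Sum>k\<le>j. (-1) ^ (k + j + 1) * B_coeff k j \<nu> * (deriv ^^ (2 * n - 2 * j - 2)) (p_fun L f g \<nu> (2 * k + 1)) z))) \<and>
        (\<nu> \<notin> uminus ` pos_upto (2 * n) \<longrightarrow> (\<forall>z\<in>D.
          (deriv ^^ (2 * n + 1)) (\<lambda>w. G \<nu> w / branch_pow L w \<nu>) z =
            (\<Sum>k\<le>n. (-1) ^ (n + k + 1) * B_coeff k n \<nu> * (G (\<nu> + 2 * of_nat k + 1) z / branch_pow L z \<nu>))
            + (\<Sum>j\<le>n. \<Sum>k\<le>j. (-1) ^ (k + j) * A_coeff k j \<nu> * (deriv ^^ (2 * n - 2 * j)) (p_fun L f g \<nu> (2 * k)) z)
            + (\<Sum>j<n. \<Sum>k\<le>j. (-1) ^ (k + j + 1) * B_coeff k j \<nu> * (deriv ^^ (2 * n - 2 * j - 1)) (p_fun L f g \<nu> (2 * k + 1)) z))) \<and>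
        (\<nu> \<notin> pos_upto (2 * n - 1) \<longrightarrow> (\<forall>z\<in>D.
          (deriv ^^ (2 * n)) (\<lambda>w. branch_pow L w \<nu> * G \<nu> w) z =
            (\<Sum>k\<le>n. (-1) ^ (n + k) * A_coeff k n (- \<nu>) * branch_pow L z \<nu> * G (\<nu> - 2 * of_nat k) z)
            + (\<Sum>j<n. \<Sum>k\<le>j. (-1) ^ (k + j) * A_coeff k j (- \<nu>) * (deriv ^^ (2 * n - 2 * j - 1)) (q_fun L f g \<nu> (2 * k)) z)
            + (\<Sum>j<n. \<Sum>k\<le>j. (-1) ^ (k + j) * B_coeff k j (- \<nu>) * (deriv ^^ (2 * n - 2 * j - 2)) (q_fun L f g \<nu> (2 * k + 1)) z))) \<and>
        (\<nu> \<notin> pos_upto (2 * n) \<longrightarrow> (\<forall>z\<in>D.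
          (deriv ^^ (2 * n + 1)) (\<lambda>w. branch_pow L w \<nu> * G \<nu> w) z =
            (\<Sum>k\<le>n. (-1) ^ (n + k) * B_coeff k n (- \<nu>) * branch_pow L z \<nu> * G (\<nu> - 2 * of_nat k - 1) z)
            + (\<Sum>j\<le>n. \<Sum>k\<le>j. (-1) ^ (k + j) * A_coeff k j (- \<nu>) * (deriv ^^ (2 * n - 2 * j)) (q_fun L f g \<nu> (2 * k)) z)
            + (\<Sum>j<n. \<Sum>k\<le>j. (-1) ^ (k + j) * B_coeff k j (- \<nu>) * (deriv ^^ (2 * n - 2 * j - 1)) (q_fun L f g \<nu> (2 * k + 1)) z))))"
proof -
  have nz_p: "\<nu> + of_nat l \<noteq> 0" if "\<nu> \<notin> uminus ` pos_upto N" "l \<in> {1..N}" for N l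
    using that by (auto simp: pos_upto_def image_iff add_eq_0_iff2)
  have nz_q: "- \<nu> + of_nat l \<noteq> 0" if "\<nu> \<notin> pos_upto N" "l \<in> {1..N}" for N l
    using that by (auto simp: pos_upto_def)
  have shift: "\<nu> + of_nat (2 * k) = \<nu> + 2 * of_nat k" "\<nu> + of_nat (2 * k + 1) = \<nu> + 2 * of_nat k + 1"
      "\<nu> - of_nat (2 * k) = \<nu> - 2 * of_nat k" "\<nu> - of_nat (2 * k + 1) = \<nu> - 2 * of_nat k - 1"
      "\<nu> + of_nat 0 = \<nu>" "\<nu> - of_nat 0 = \<nu>" for k
    by simp_all
  have F: "F \<mu> field_differentiable at z \<and>
        F (\<mu> - 1) z + 1 * F (\<mu> + 1) z = 2 * deriv (F \<mu>) z + f \<mu> z \<and>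
        F (\<mu> - 1) z - 1 * F (\<mu> + 1) z = 2 * \<mu> / z * F \<mu> z + g \<mu> z"
    if "F_family D f g F" "z \<in> D" for \<mu> z
    using that by (simp add: F_family_def)
  have G: "G \<mu> field_differentiable at z \<and>
        G (\<mu> - 1) z + - 1 * G (\<mu> + 1) z = 2 * deriv (G \<mu>) z + f \<mu> z \<and>
        G (\<mu> - 1) z - - 1 * G (\<mu> + 1) z = 2 * \<mu> / z * G \<mu> z + g \<mu> z"
    if "G_family D f g G" "z \<in> D" for \<mu> z
    using that by (simp add: G_family_def)
  note norm = power_one mult_1_left mult_1_right mult.assoc add_ac power_minus_one_diff
  show ?thesis
  proof (intro conjI impI ballI, goal_cases)
    case (1 z)
    interpret derivative_chain D \<nu> 1 1
      "\<lambda>l w. F (\<nu> + of_nat l) w / branch_pow L w \<nu>" "p_fun L f g \<nu>" n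
      by (rule derivative_chain_p [OF branch p_smooth F [OF 1(1)]])
    show ?case
      using higher_deriv_eq(1) [OF order_refl nz_p [OF 1(2)] 1(3)]
      unfolding even_sum_def even_coeff_def odd_coeff_def shift by (simp only: norm cong: sum.cong)
    next
    case (2 z)
    interpret derivative_chain D \<nu> 1 1
      "\<lambda>l w. F (\<nu> + of_nat l) w / branch_pow L w \<nu>" "p_fun L f g \<nu>" n
      by (rule derivative_chain_p [OF branch p_smooth F [OF 2(1)]])
    show ?case
      using higher_deriv_eq(2) [OF order_refl nz_p [OF 2(2)] 2(3)]
      unfolding odd_sum_def even_coeff_def odd_coeff_def shift by (simp only: norm cong: sum.cong)
    next
    case (3 z)
    interpret derivative_chain D "- \<nu>" 1 1
      "\<lambda>l w. branch_pow L w \<nu> * F (\<nu> - of_nat l) w" "q_fun L f g \<nu>" n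
      by (rule derivative_chain_q [OF branch q_smooth F [OF 3(1)]])
    show ?case
      using higher_deriv_eq(1) [OF order_refl nz_q [OF 3(2)] 3(3)]
      unfolding even_sum_def even_coeff_def odd_coeff_def shift by (simp only: norm cong: sum.cong)
    next
    case (4 z)
    interpret derivative_chain D "- \<nu>" 1 1
      "\<lambda>l w. branch_pow L w \<nu> * F (\<nu> - of_nat l) w" "q_fun L f g \<nu>" n
      by (rule derivative_chain_q [OF branch q_smooth F [OF 4(1)]])
    show ?case
      using higher_deriv_eq(2) [OF order_refl nz_q [OF 4(2)] 4(3)]
      unfolding odd_sum_def even_coeff_def odd_coeff_def shift by (simp only: norm cong: sum.cong)
    next
    \<comment> \<open>Here the steps up carry the sign. Their numbers j+k and j+k+1 account for the
      extra minus sign at the coefficients \<open>B\<close>.\<close>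
    case (5 z)
    interpret derivative_chain D \<nu> 1 "- 1"
      "\<lambda>l w. G (\<nu> + of_nat l) w / branch_pow L w \<nu>" "p_fun L f g \<nu>" n
      by (rule derivative_chain_p [OF branch p_smooth G [OF 5(1)]])
    show ?case
      using higher_deriv_eq(1) [OF order_refl nz_p [OF 5(2)] 5(3)]
      unfolding even_sum_def even_coeff_def odd_coeff_def shift by (simp only: norm cong: sum.cong)
    next
    case (6 z)
    interpret derivative_chain D \<nu> 1 "- 1"
      "\<lambda>l w. G (\<nu> + of_nat l) w / branch_pow L w \<nu>" "p_fun L f g \<nu>" n
      by (rule derivative_chain_p [OF branch p_smooth G [OF 6(1)]])
    show ?case
      using higher_deriv_eq(2) [OF order_refl nz_p [OF 6(2)] 6(3)]
      unfolding odd_sum_def even_coeff_def odd_coeff_def shift by (simp only: norm cong: sum.cong)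
    next
    \<comment> \<open>Now the steps down carry the sign. Their number j-k is the same for both
      parities, so \<open>A\<close> and \<open>B\<close> have equal signs.\<close>
    case (7 z)
    interpret derivative_chain D "- \<nu>" "- 1" 1
      "\<lambda>l w. branch_pow L w \<nu> * G (\<nu> - of_nat l) w" "q_fun L f g \<nu>" n
      by (rule derivative_chain_q [OF branch q_smooth G [OF 7(1)]])
    show ?case
      using higher_deriv_eq(1) [OF order_refl nz_q [OF 7(2)] 7(3)]
      unfolding even_sum_def even_coeff_def odd_coeff_def shift by (simp only: norm cong: sum.cong)
    next
    case (8 z)
    interpret derivative_chain D "- \<nu>" "- 1" 1
      "\<lambda>l w. branch_pow L w \<nu> * G (\<nu> - of_nat l) w" "q_fun L f g \<nu>" n
      by (rule derivative_chain_q [OF branch q_smooth G [OF 8(1)]])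
    show ?case
      using higher_deriv_eq(2) [OF order_refl nz_q [OF 8(2)] 8(3)]
      unfolding odd_sum_def even_coeff_def odd_coeff_def shift by (simp only: norm cong: sum.cong)
  qed
qed

end
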